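(* Let $P$ be a probability measure on $[0,\infty)$ and consider the equation $\dot u(t) = -\int_0^\infty u(t-s)\,\mathrm{d}P(s)$ for $t>0$, subject to the constant initial datum $u(s)\equiv 1$ for $s\le 0$. If there exists some $\mu>1$ such that $$\mathbb{M}_P(2\mu)\le \mu^2 \qquad\text{and}\qquad \mathbb{M}_P(\mu)\bigl(\mathbb{M}_P(\mu)-1\bigr)<\mu ,$$ then the solution $u=u(t)$ converges monotonically exponentially to zero as $t\to\infty$ with rate at least $$2\left(\frac{\mathbb{M}_P(\mu)\bigl(\mathbb{M}_P(\mu)-1\bigr)}{\mu}-1\right).$$
   Context: For a probability measure $P$ on $[0,\infty)$ and $\mu>0$, the exponential moment of $P$ is $\mathbb{M}_P(\mu) := \int_0^\infty e^{\mu s}\,\mathrm{d}P(s)$.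
   Formalization: The stated rate is proved for the square u(t)², so u itself converges with half that rate; for u itself the stated rate fails, e.g. for P the Dirac measure at 0, where u(t)=exp(-t) but the stated rate is -2. *)

theory Defs
  imports "HOL-Probability.Probability"
begin

(* Valued in ennreal, so that an infinite moment is really infinite; the Bochner
   integral would return 0 instead. *)
definition exp_moment :: "real measure \<Rightarrow> real \<Rightarrow> ennreal" where
  "exp_moment P \<mu> = (\<integral>\<^sup>+ s. ennreal (exp (\<mu> * s)) \<partial>P)"

(* Solutions of u'(t) = - \<integral> u(t - s) dP(s) for t > 0 with u = 1 on the nonpositive half-line.
   Continuity matters at t = 0: it ties the solution for t > 0 to the initial datum.
   It also makes u bounded on every half-line up to t, so the integral always exists
   when P is a Borel probability measure on {0..}. *)
definition delay_solution :: "real measure \<Rightarrow> (real \<Rightarrow> real) \<Rightarrow> bool" where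
  "delay_solution P u \<longleftrightarrow>
     continuous_on UNIV u \<and>
     (\<forall>s\<le>0. u s = 1) \<and>
     (\<forall>t>0. (u has_real_derivative - (\<integral>s. u (t - s) \<partial>P)) (at t))"

(* The rate r is the signed exponent, hence negative. With M the exponential moment at \<mu>, the rate
   2 * (M * (M - 1) / \<mu> - 1) is the one in the energy estimate
     (u\<^sup>2)' = - 2 * u\<^sup>2 + 2 * u * \<integral> (u(t) - u(t - s)) dP(s) \<le> 2 * (M * (M - 1) / \<mu> - 1) * u\<^sup>2,
   so it is a rate for the square of the solution. It is not one for the solution itself: if P is
   the Dirac measure at 0, then u(t) = exp(-t), whereas this rate is -2. *)
definition exp_decay :: "(real \<Rightarrow> real) \<Rightarrow> real \<Rightarrow> bool" where
  "exp_decay f r \<longleftrightarrow> r < 0 \<and> (\<exists>C>0. \<forall>t\<ge>0. \<bar>f t\<bar> \<le> C * exp (r * t))"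

end

theory Submission
  imports Defs
begin

text \<open>Write \<open>M\<close> for the exponential moment at \<open>\<mu>\<close>. The arithmetic-geometric mean inequality
  turns the bound on the moment at \<open>2\<mu>\<close> into \<open>M \<le> \<mu>\<close>, and this makes
  \<open>v(t) = e\<^sup>\<mu>\<^sup>t u(t)\<close> nondecreasing: as \<open>v'(t) = \<mu> v(t) - \<integral> e\<^sup>\<mu>\<^sup>s v(t - s) dP(s)\<close>,
  if \<open>v\<close> is nondecreasing up to \<open>T\<close> and \<open>v' \<ge> -c\<close> on \<open>(T, T + 1/(2\<mu>))\<close>, then \<open>v' \<ge> -c/2\<close>
  there, hence \<open>v' \<ge> 0\<close>. So \<open>u\<close> is positive, hence nonincreasing, hence \<open>u' \<le> -u\<close> and
  \<open>u(t) \<le> e\<^sup>-\<^sup>t\<close>. Since \<open>M \<ge> 1\<close>, the claimed rate for \<open>u\<^sup>2\<close> is at least \<open>-2\<close>.\<close>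

section \<open>The delay equation and boundedness of its solution\<close>

locale delay_equation = prob_space P for P :: "real measure" +
  fixes u :: "real \<Rightarrow> real"
  assumes sets_P: "sets P = sets (restrict_space borel {0..})"
    and solution: "delay_solution P u"
begin

lemma space_P: "space P = {0..}"
  using sets_eq_imp_space_eq[OF sets_P] by (simp add: space_restrict_space)

lemma borel_measurable_P: "f \<in> borel_measurable borel \<Longrightarrow> f \<in> borel_measurable P"
  using measurable_cong_sets[OF sets_P refl] measurable_restrict_space1 by blast

lemma continuous_u: "continuous_on A u"
  and u_history: "t \<le> 0 \<Longrightarrow> u t = 1"
  and has_derivative_u: "t > 0 \<Longrightarrow> (u has_real_derivative - (\<integral>s. u (t - s) \<partial>P)) (at t)"
  using solution continuous_on_subset unfolding delay_solution_def by blast+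

text \<open>Continuity bounds \<open>u\<close> on a compact interval, and before it the history is
  constant. This makes the delay integral exist and supplies the crude first bound in
  \<open>scaled_mono_step\<close>.\<close>

lemma u_bounded_on_ray:
  obtains B where "\<And>x. x \<le> T \<Longrightarrow> \<bar>u x\<bar> \<le> B"
proof -
  have "bounded (u ` {0..T})"
    by (intro compact_imp_bounded compact_continuous_image continuous_u) simp
  then obtain B where B: "\<forall>x\<in>{0..T}. \<bar>u x\<bar> \<le> B"
    by (auto simp: bounded_iff)
  show thesis
  proof (rule that)
    show "\<bar>u x\<bar> \<le> max 1 B" if "x \<le> T" for x
      using B u_history[of x] that by (cases "x \<le> 0") (auto simp: le_max_iff_disj)
  qed
qed

lemma integrable_delayed: "integrable P (\<lambda>s. u (t - s))"
proof -
  obtain B where "\<And>x. x \<le> t \<Longrightarrow> \<bar>u x\<bar> \<le> B"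
    using u_bounded_on_ray by blast
  moreover have "(\<lambda>s. u (t - s)) \<in> borel_measurable borel"
    by (intro borel_measurable_continuous_onI continuous_on_compose2[OF continuous_u[of UNIV]]
        continuous_intros) auto
  ultimately show ?thesis
    by (intro integrable_const_bound[where B = B] AE_I2 borel_measurable_P) (auto simp: space_P)
qed

section \<open>Monotonicity of the exponentially scaled solution\<close>

definition scaled :: "real \<Rightarrow> real \<Rightarrow> real" where
  "scaled \<mu> t = exp (\<mu> * t) * u t"

lemma has_derivative_scaled:
  assumes "t > 0"
  shows "(scaled \<mu> has_real_derivative exp (\<mu> * t) * (\<mu> * u t - (\<integral>s. u (t - s) \<partial>P))) (at t)"
  unfolding scaled_def
  by (rule derivative_eq_intros has_derivative_u[OF assms] refl)+ (simp add: algebra_simps)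

lemma continuous_scaled: "continuous_on A (scaled \<mu>)"
  unfolding scaled_def by (intro continuous_intros continuous_u)

text \<open>The mean value theorem needs the derivative only on the open interval, so
  \<open>a = 0\<close> is allowed although the equation is given only for positive times.\<close>

lemma scaled_difference_ge:
  assumes "0 \<le> a" "a \<le> b"
    and lower: "\<And>t. a < t \<Longrightarrow> t < b \<Longrightarrow>
      - c \<le> exp (\<mu> * t) * (\<mu> * u t - (\<integral>s. u (t - s) \<partial>P))"
  shows "- c * (b - a) \<le> scaled \<mu> b - scaled \<mu> a"
proof (cases "a = b")
  case False
  then have "a < b" using assms by simp
  moreover have "scaled \<mu> differentiable (at x)" if "a < x" for x
    using has_derivative_scaled[of x \<mu>] that \<open>0 \<le> a\<close> by (auto simp: real_differentiable_def)
  ultimately obtain l z where z: "a < z" "z < b" "(scaled \<mu> has_real_derivative l) (at z)"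
    and l: "scaled \<mu> b - scaled \<mu> a = (b - a) * l"
    using MVT[OF _ continuous_scaled] by meson
  have "l \<ge> - c"
    using DERIV_unique[OF z(3) has_derivative_scaled] z(1,2) lower[of z] \<open>0 \<le> a\<close> by simp
  then have "(b - a) * - c \<le> (b - a) * l"
    using \<open>a < b\<close> by (intro mult_left_mono) auto
  then show ?thesis unfolding l by (simp add: mult.commute)
qed simp

context
  fixes \<mu> M :: real
  assumes mu_pos: "\<mu> > 0"
    and integrable_exp: "integrable P (\<lambda>s. exp (\<mu> * s))"
    and M_def: "M = (\<integral>s. exp (\<mu> * s) \<partial>P)"
    and M_le: "M \<le> \<mu>"
begin

text \<open>Over a window of length \<open>1 / (2 * \<mu>)\<close> a slope of at least
  \<open>- c\<close> lets \<open>scaled \<mu>\<close> fall by at most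
  \<open>d = c / (2 * \<mu>)\<close>. Past values thus exceed the current one by at most
  \<open>d\<close>, which with \<open>M \<le> \<mu>\<close> costs only
  \<open>\<mu> * d = c / 2\<close> in the derivative.\<close>

lemma scaled_derivative_improve:
  assumes "0 \<le> T" and mono: "mono_on {..T} (scaled \<mu>)" and "0 \<le> c"
    and lower: "\<And>t. T < t \<Longrightarrow> t < T + 1 / (2 * \<mu>) \<Longrightarrow>
      - c \<le> exp (\<mu> * t) * (\<mu> * u t - (\<integral>s. u (t - s) \<partial>P))"
    and t: "T < t" "t < T + 1 / (2 * \<mu>)"
  shows "- (c / 2) \<le> exp (\<mu> * t) * (\<mu> * u t - (\<integral>s. u (t - s) \<partial>P))"
proof -
  define d where "d = c / (2 * \<mu>)"
  have "0 \<le> d" using \<open>0 \<le> c\<close> mu_pos by (simp add: d_def)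
  have drop: "scaled \<mu> x - d \<le> scaled \<mu> t" if "T \<le> x" "x \<le> t" for x
  proof -
    have "- c * (t - x) \<le> scaled \<mu> t - scaled \<mu> x"
      using that t \<open>0 \<le> T\<close> by (intro scaled_difference_ge lower) auto
    moreover have "c * (t - x) \<le> c * (1 / (2 * \<mu>))"
      using that t \<open>0 \<le> c\<close> by (intro mult_left_mono) auto
    ultimately show ?thesis by (simp add: d_def)
  qed
  \<comment> \<open>Short delays stay inside the window and use \<open>drop\<close>; longer ones are
    compared through \<open>T\<close>, using monotonicity up to there.\<close>
  have past: "scaled \<mu> (t - s) \<le> scaled \<mu> t + d" if "0 \<le> s" for s
  proof (cases "T \<le> t - s")
    case True
    then show ?thesis using drop[of "t - s"] that by simp
  next
    case False
    then have "scaled \<mu> (t - s) \<le> scaled \<mu> T"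
      by (intro mono_onD[OF mono]) auto
    then show ?thesis using drop[of T] t by simp
  qed
  \<comment> \<open>As \<open>scaled \<mu> 0 = 1\<close>, this gives the sign that later permits
    replacing \<open>M\<close> by \<open>\<mu>\<close>.\<close>
  have "scaled \<mu> 0 \<le> scaled \<mu> T"
    using \<open>0 \<le> T\<close> by (intro mono_onD[OF mono]) auto
  then have "0 \<le> scaled \<mu> t + d"
    using drop[of T] t u_history[of 0] by (simp add: scaled_def)
  have "exp (\<mu> * t) * (\<integral>s. u (t - s) \<partial>P) = (\<integral>s. exp (\<mu> * t) * u (t - s) \<partial>P)"
    by simp
  also have "\<dots> \<le> (\<integral>s. exp (\<mu> * s) * (scaled \<mu> t + d) \<partial>P)"
  proof (intro integral_mono)
    fix s assume "s \<in> space P"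
    then have "exp (\<mu> * s) * scaled \<mu> (t - s) \<le> exp (\<mu> * s) * (scaled \<mu> t + d)"
      using past[of s] by (simp add: space_P)
    moreover have "exp (\<mu> * s) * scaled \<mu> (t - s) = exp (\<mu> * t) * u (t - s)"
      by (simp add: scaled_def right_diff_distrib flip: exp_add mult.assoc)
    ultimately show "exp (\<mu> * t) * u (t - s) \<le> exp (\<mu> * s) * (scaled \<mu> t + d)" by simp
  qed (use integrable_delayed integrable_exp in simp_all)
  also have "\<dots> = M * (scaled \<mu> t + d)"
    by (simp add: M_def)
  also have "\<dots> \<le> \<mu> * (scaled \<mu> t + d)"
    using M_le \<open>0 \<le> scaled \<mu> t + d\<close> by (rule mult_right_mono)
  also have "\<dots> = exp (\<mu> * t) * (\<mu> * u t) + c / 2"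
    using mu_pos by (simp add: scaled_def d_def field_simps)
  finally show ?thesis by (simp add: algebra_simps)
qed

text \<open>Boundedness of \<open>u\<close> gives some lower bound \<open>- c\<close> for the
  derivative on the window; repeated halving drives it to 0.\<close>

lemma scaled_mono_step:
  assumes "0 \<le> T" and mono: "mono_on {..T} (scaled \<mu>)"
  shows "mono_on {..T + 1 / (2 * \<mu>)} (scaled \<mu>)"
proof -
  define D where "D t = exp (\<mu> * t) * (\<mu> * u t - (\<integral>s. u (t - s) \<partial>P))" for t
  define I where "I = {T<..<T + 1 / (2 * \<mu>)}"
  obtain B where B: "\<And>x. x \<le> T + 1 / (2 * \<mu>) \<Longrightarrow> \<bar>u x\<bar> \<le> B"
    using u_bounded_on_ray by blast
  \<comment> \<open>The worst case: \<open>u t = - B\<close>, the delay integral equal to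
    \<open>B\<close>, and the exponential at the right end of the window.\<close>
  define c where "c = exp (\<mu> * (T + 1 / (2 * \<mu>))) * (\<mu> * B + B)"
  have "0 \<le> B" using B[of 0] \<open>0 \<le> T\<close> mu_pos by simp
  then have "0 \<le> c" using mu_pos by (simp add: c_def)
  have "- c \<le> D t" if "t \<in> I" for t
  proof -
    have t: "t \<le> T + 1 / (2 * \<mu>)" using that by (simp add: I_def)
    have "(\<integral>s. u (t - s) \<partial>P) \<le> (\<integral>s. B \<partial>P)"
    proof (intro integral_mono integrable_delayed)
      fix s assume "s \<in> space P"
      then show "u (t - s) \<le> B" using B[of "t - s"] t by (simp add: space_P)
    qed simp
    moreover have "\<mu> * (- B) \<le> \<mu> * u t"
      using B[OF t] mu_pos by (intro mult_left_mono) auto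
    ultimately have "- (\<mu> * B + B) \<le> \<mu> * u t - (\<integral>s. u (t - s) \<partial>P)"
      by (simp add: prob_space)
    then have "exp (\<mu> * t) * - (\<mu> * B + B) \<le> D t"
      unfolding D_def by (intro mult_left_mono) auto
    moreover have "exp (\<mu> * t) * (\<mu> * B + B) \<le> c"
      unfolding c_def using t mu_pos \<open>0 \<le> B\<close> by (intro mult_right_mono) auto
    ultimately show ?thesis by (simp add: algebra_simps)
  qed
  then have halved: "\<forall>t\<in>I. - (c / 2 ^ n) \<le> D t" for n
  proof (induction n)
    case (Suc n)
    have "- (c / 2 ^ n / 2) \<le> D t" if "t \<in> I" for t
      unfolding D_def
      by (rule scaled_derivative_improve[OF assms])
        (use Suc that \<open>0 \<le> c\<close> in \<open>auto simp: D_def I_def\<close>)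
    then show ?case by (simp add: field_simps)
  qed simp
  have D_nonneg: "0 \<le> D t" if "t \<in> I" for t
  proof (rule LIMSEQ_le_const2)
    show "(\<lambda>n. - (c / 2 ^ n)) \<longlonglongrightarrow> 0"
      using LIMSEQ_divide_realpow_zero[of 2 c] tendsto_minus by fastforce
  qed (use halved that in blast)
  have late: "scaled \<mu> x \<le> scaled \<mu> y" if "T \<le> x" "x \<le> y" "y \<le> T + 1 / (2 * \<mu>)" for x y
    using scaled_difference_ge[of x y 0 \<mu>] D_nonneg that \<open>0 \<le> T\<close> by (auto simp: D_def I_def)
  show ?thesis
  proof (rule mono_onI)
    fix x y assume xy: "x \<in> {..T + 1 / (2 * \<mu>)}" "y \<in> {..T + 1 / (2 * \<mu>)}" "x \<le> y"
    consider "y \<le> T" | "T \<le> x" | "x \<le> T" "T \<le> y" using xy(3) by linarith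
    then show "scaled \<mu> x \<le> scaled \<mu> y"
    proof cases
      case 1
      then show ?thesis using mono_onD[OF mono] xy by auto
    next
      case 2
      then show ?thesis using late xy by auto
    next
      case 3
      then have "scaled \<mu> x \<le> scaled \<mu> T" using mono_onD[OF mono] by auto
      also have "\<dots> \<le> scaled \<mu> y" using late 3 xy by auto
      finally show ?thesis .
    qed
  qed
qed

text \<open>The window length does not depend on \<open>T\<close>, so finitely many steps pass any
  point. The induction starts from the history, where \<open>scaled \<mu> t\<close> is
  \<open>exp (\<mu> * t)\<close>.\<close>

lemma mono_scaled: "mono (scaled \<mu>)"
proof -
  have upto: "mono_on {..real n * (1 / (2 * \<mu>))} (scaled \<mu>)" for n
  proof (induction n)
    case 0
    show ?case using mu_pos by (auto intro!: mono_onI simp: scaled_def u_history)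
  next
    case (Suc n)
    then show ?case
      using scaled_mono_step[of "real n * (1 / (2 * \<mu>))"] mu_pos
      by (simp add: add_divide_distrib add.commute)
  qed
  show ?thesis
  proof (rule monoI)
    fix x y :: real assume "x \<le> y"
    obtain n where "y < real n * (1 / (2 * \<mu>))"
      using reals_Archimedean3[of "1 / (2 * \<mu>)"] mu_pos by auto
    then show "scaled \<mu> x \<le> scaled \<mu> y"
      using \<open>x \<le> y\<close> by (intro mono_onD[OF upto[of n]]) auto
  qed
qed

section \<open>Positivity, monotonicity and decay of the solution\<close>

lemma u_pos: "0 < u t"
proof -
  \<comment> \<open>The comparison point lies in the history, where \<open>scaled \<mu>\<close> is a
    positive exponential.\<close>
  have "0 < scaled \<mu> (min t 0)" by (simp add: scaled_def u_history)
  also have "\<dots> \<le> scaled \<mu> t" by (rule monoD[OF mono_scaled]) simp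
  finally show ?thesis by (simp add: scaled_def zero_less_mult_iff)
qed

lemma antimono_u: "antimono u"
proof (rule antimonoI)
  fix x y :: real assume "x \<le> y"
  have nonneg: "u b \<le> u a" if "0 \<le> a" "a \<le> b" for a b
  proof (rule DERIV_nonpos_imp_decreasing_open[OF that(2)])
    fix t assume "a < t" "t < b"
    moreover have "0 \<le> (\<integral>s. u (t - s) \<partial>P)"
      by (intro integral_nonneg_AE AE_I2) (simp add: u_pos less_imp_le)
    ultimately show "\<exists>l. (u has_real_derivative l) (at t) \<and> l \<le> 0"
      using has_derivative_u[of t] that by (auto intro!: exI[of _ "- (\<integral>s. u (t - s) \<partial>P)"])
  qed (rule continuous_u)
  \<comment> \<open>A negative \<open>x\<close> is moved to 0, where \<open>u\<close> has the same
    value 1.\<close>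
  show "u y \<le> u x"
    using nonneg[of "max x 0" y] \<open>x \<le> y\<close> u_history[of x] u_history[of y] u_history[of 0]
    by (cases "y \<le> 0"; cases "x \<le> 0") auto
qed

text \<open>Every delayed value is at least the current one, so averaging over \<open>P\<close>
  gives \<open>u' \<le> - u\<close>, and \<open>exp t * u t\<close> cannot rise above its value 1 at
  time 0.\<close>

lemma u_le_exp:
  assumes "0 \<le> t"
  shows "u t \<le> exp (- t)"
proof -
  have "exp t * u t \<le> exp 0 * u 0"
  proof (rule DERIV_nonpos_imp_decreasing_open[OF assms])
    fix x :: real assume "0 < x" "x < t"
    have "(\<integral>s. u x \<partial>P) \<le> (\<integral>s. u (x - s) \<partial>P)"
      by (intro integral_mono integrable_delayed) (auto simp: space_P intro!: antimonoD[OF antimono_u])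
    then have "exp x * (u x - (\<integral>s. u (x - s) \<partial>P)) \<le> 0"
      by (simp add: prob_space mult_le_0_iff)
    moreover have "((\<lambda>t. exp t * u t) has_real_derivative
        exp x * (u x - (\<integral>s. u (x - s) \<partial>P))) (at x)"
      using has_derivative_scaled[OF \<open>0 < x\<close>, of 1] by (simp add: scaled_def[abs_def])
    ultimately show "\<exists>l. ((\<lambda>t. exp t * u t) has_real_derivative l) (at x) \<and> l \<le> 0"
      by blast
  qed (intro continuous_intros continuous_u)
  then show ?thesis by (simp add: u_history exp_minus field_simps)
qed

end

section \<open>Bounds on the exponential moment\<close>

lemma exp_moment_le:
  assumes "\<mu> > 0" and "exp_moment P (2 * \<mu>) \<le> ennreal (\<mu>\<^sup>2)"
  shows "exp_moment P \<mu> \<le> ennreal \<mu>"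
proof -
  have meas: "(\<lambda>s. exp (a * s)) \<in> borel_measurable P" for a :: real
    by (intro borel_measurable_P) measurable
  \<comment> \<open>The arithmetic-geometric mean inequality, weighted so that each term integrates
    to at most \<open>\<mu> / 2\<close>.\<close>
  have pointwise: "exp (\<mu> * s) \<le> 1 / (2 * \<mu>) * exp (2 * \<mu> * s) + \<mu> / 2" for s
  proof -
    have "0 \<le> (exp (\<mu> * s) - \<mu>)\<^sup>2" by simp
    also have "(exp (\<mu> * s) - \<mu>)\<^sup>2 = exp (2 * \<mu> * s) - 2 * \<mu> * exp (\<mu> * s) + \<mu>\<^sup>2"
      by (simp add: power2_diff mult.assoc flip: exp_double)
    finally show ?thesis using \<open>\<mu> > 0\<close> by (simp add: field_simps power2_eq_square)
  qed
  have "exp_moment P \<mu> \<le>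
      (\<integral>\<^sup>+ s. ennreal (1 / (2 * \<mu>)) * ennreal (exp (2 * \<mu> * s)) + ennreal (\<mu> / 2) \<partial>P)"
    unfolding exp_moment_def using pointwise \<open>\<mu> > 0\<close>
    by (intro nn_integral_mono) (simp add: ennreal_leI flip: ennreal_mult ennreal_plus)
  also have "\<dots> = ennreal (1 / (2 * \<mu>)) * exp_moment P (2 * \<mu>) + ennreal (\<mu> / 2)"
    unfolding exp_moment_def using meas
    by (simp add: nn_integral_add nn_integral_cmult emeasure_space_1)
  also have "\<dots> \<le> ennreal (1 / (2 * \<mu>)) * ennreal (\<mu>\<^sup>2) + ennreal (\<mu> / 2)"
    using assms(2) by (intro add_mono mult_left_mono) auto
  also have "\<dots> = ennreal \<mu>"
    using \<open>\<mu> > 0\<close> by (simp add: power2_eq_square field_simps flip: ennreal_mult ennreal_plus)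
  finally show ?thesis .
qed

text \<open>Delays are nonnegative, so the integrand is at least 1. This keeps the claimed rate from
  falling below -2.\<close>

lemma exp_moment_ge_1: "\<mu> \<ge> 0 \<Longrightarrow> 1 \<le> exp_moment P \<mu>"
proof -
  assume "\<mu> \<ge> 0"
  then have "(\<integral>\<^sup>+ s. 1 \<partial>P) \<le> exp_moment P \<mu>"
    unfolding exp_moment_def by (intro nn_integral_mono) (simp add: space_P)
  then show ?thesis by (simp add: emeasure_space_1)
qed

end

theorem theorem1:
  fixes P :: "real measure" and u :: "real \<Rightarrow> real" and \<mu> :: real
  assumes "prob_space P"
    and "sets P = sets (restrict_space borel {0..})"
    and "delay_solution P u"
    and "\<mu> > 1"
    and "exp_moment P (2 * \<mu>) \<le> ennreal (\<mu>\<^sup>2)"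
    and "exp_moment P \<mu> * (exp_moment P \<mu> - 1) < ennreal \<mu>"
  shows "antimono_on {0..} u \<and> (u \<longlongrightarrow> 0) at_top \<and>
         exp_decay (\<lambda>t. (u t)\<^sup>2)
           (2 * (enn2real (exp_moment P \<mu>) * (enn2real (exp_moment P \<mu>) - 1) / \<mu> - 1))"
proof -
  interpret delay_equation P u
    using assms(1-3) by (simp add: delay_equation_def delay_equation_axioms_def)
  define M where "M = enn2real (exp_moment P \<mu>)"
  define r where "r = 2 * (M * (M - 1) / \<mu> - 1)"
  have "\<mu> > 0" using assms(4) by simp
  have le: "exp_moment P \<mu> \<le> ennreal \<mu>"
    using exp_moment_le \<open>\<mu> > 0\<close> assms(5) by blast
  \<comment> \<open>Finiteness matters here: \<open>enn2real\<close> would send an infinite moment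
    to 0.\<close>
  then have M: "exp_moment P \<mu> = ennreal M"
    unfolding M_def by (simp add: le_less_trans)
  have "M \<ge> 0" by (simp add: M_def)
  have "M \<le> \<mu>" using le \<open>\<mu> > 0\<close> by (simp add: M)
  have "M \<ge> 1" using exp_moment_ge_1[of \<mu>] \<open>\<mu> > 0\<close> \<open>M \<ge> 0\<close> by (simp add: M)
  \<comment> \<open>Subtraction in \<open>ennreal\<close> truncates at 0; because
    \<open>M \<ge> 1\<close>, it agrees with real subtraction here.\<close>
  have "ennreal (M * (M - 1)) < ennreal \<mu>"
    using assms(6) \<open>M \<ge> 1\<close> by (simp add: M ennreal_mult ennreal_minus flip: ennreal_1)
  then have "M * (M - 1) < \<mu>"
    using \<open>M \<ge> 1\<close> by (simp add: ennreal_less_iff)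
  then have "r < 0" using \<open>\<mu> > 0\<close> by (simp add: r_def field_simps)
  \<comment> \<open>Here \<open>M * (M - 1)\<close> is nonnegative; -2 is the rate of
    \<open>u\<^sup>2\<close> that follows from \<open>u t \<le> exp (- t)\<close>.\<close>
  have "- 2 \<le> r" using \<open>M \<ge> 1\<close> \<open>\<mu> > 0\<close> by (simp add: r_def)
  have meas: "(\<lambda>s. exp (\<mu> * s)) \<in> borel_measurable P"
    by (intro borel_measurable_P) measurable
  have int: "integrable P (\<lambda>s. exp (\<mu> * s))"
    using M meas by (intro integrableI_nonneg) (auto simp: exp_moment_def)
  have M_eq: "M = (\<integral>s. exp (\<mu> * s) \<partial>P)"
    using meas by (simp add: M_def exp_moment_def integral_eq_nn_integral)
  note setting = \<open>\<mu> > 0\<close> int M_eq \<open>M \<le> \<mu>\<close>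
  note pos = u_pos[OF setting] and decay = u_le_exp[OF setting]
  have "antimono_on {0..} u"
    using antimono_u[OF setting] by (auto simp: monotone_on_def)
  moreover have "(u \<longlongrightarrow> 0) at_top"
  proof (rule tendsto_sandwich)
    show "\<forall>\<^sub>F t in at_top. (0 :: real) \<le> u t"
      using pos by (simp add: less_imp_le)
    show "\<forall>\<^sub>F t in at_top. u t \<le> exp (- t)"
      using eventually_ge_at_top[of 0] by eventually_elim (rule decay)
    show "((\<lambda>t :: real. exp (- t)) \<longlongrightarrow> 0) at_top"
      by (rule filterlim_compose[OF exp_at_bot filterlim_uminus_at_bot_at_top])
  qed simp
  moreover have "exp_decay (\<lambda>t. (u t)\<^sup>2) r"
    unfolding exp_decay_def
  \<comment> \<open>The constant is 1 since the bound \<open>exp (- t)\<close> on \<open>u t\<close>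
    carries no factor.\<close>
  proof (intro conjI exI[of _ 1] allI impI)
    fix t :: real assume "0 \<le> t"
    have "(u t)\<^sup>2 \<le> (exp (- t))\<^sup>2"
      using decay \<open>0 \<le> t\<close> pos[of t] by (intro power_mono) auto
    also have "\<dots> = exp (- 2 * t)"
      by (simp flip: exp_double)
    also have "\<dots> \<le> exp (r * t)"
      using \<open>- 2 \<le> r\<close> \<open>0 \<le> t\<close> by (simp only: exp_le_cancel_iff mult_right_mono)
    finally show "\<bar>(u t)\<^sup>2\<bar> \<le> 1 * exp (r * t)" by simp
  qed (use \<open>r < 0\<close> in auto)
  ultimately show ?thesis by (simp add: r_def M_def)
qed

end
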